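(* Let $Q\subset\mathbb{C}^n$ be a complete circular domain centered at $0\in Q$. If $f$ is holomorphic in $Q$ with homogeneous expansion $f(z)=\sum_{k=0}^\infty P_k(z)$ converging in $Q$, $f(0)=0$, and $|f(z)|<1$ for all $z\in Q$, then $$\sum_{k=1}^{\infty}|P_k(z)|\le 1\quad\text{for all } z\in \tfrac{1}{\sqrt2}Q.$$ Moreover, if $Q$ is convex, then the number $\frac1{\sqrt2}$ cannot be improved: for every $\rho\in(\frac1{\sqrt2},1]$ there exist a holomorphic $f(z)=\sum_{k\ge 0}P_k(z)$ on $Q$ with $f(0)=0$ and $|f|<1$ on $Q$, and a point $z\in\rho Q$, such that $\sum_{k=1}^\infty|P_k(z)|>1$.
   Context: A domain $Q\subset\mathbb{C}^n$ is a complete circular domain centered at $0\in Q$ if $\xi z=(\xi z_1,\ldots,\xi z_n)\in Q$ for every $z\in Q$ and every $\xi\in\mathbb{C}$ with $|\xi|\le 1$. Every holomorphic function $f$ on such a $Q$ has an expansion $f(z)=\sum_{k=0}^\infty P_k(z)$, $z\in Q$, where $P_k$ is a homogeneous polynomial of degree $k$ and $P_0=f(0)$. For $\rho>0$, the homothetic domain is $\rho Q=\{\rho z: z\in Q\}$.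
   Formalization: In the sharpness part, Q is additionally assumed to be different from the whole space C^n; for Q = C^n the claim fails, since by Liouville every bounded holomorphic f with f(0)=0 is identically zero. *)

theory Defs
  imports "HOL-Complex_Analysis.Complex_Analysis"
begin

definition complete_circular_domain :: "(complex ^ 'n) set \<Rightarrow> bool" where
  "complete_circular_domain Q \<longleftrightarrow>
     open Q \<and> connected Q \<and> 0 \<in> Q \<and>
     (\<forall>z\<in>Q. \<forall>\<xi>::complex. cmod \<xi> \<le> 1 \<longrightarrow> \<xi> *s z \<in> Q)"

text \<open>
  Holomorphy in several variables is Frechet differentiability with a complex-linear
  derivative: \<open>has_derivative\<close> supplies a bounded real-linear map, and the second conjunct
  makes it complex-linear.
\<close>

definition mv_holomorphic_on :: "(complex ^ 'n \<Rightarrow> complex) \<Rightarrow> (complex ^ 'n) set \<Rightarrow> bool" where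
  "mv_holomorphic_on f Q \<longleftrightarrow>
     (\<forall>z\<in>Q. \<exists>L. (f has_derivative L) (at z within Q) \<and>
        (\<forall>(c::complex) v. L (c *s v) = c * L v))"

definition multi_indices :: "nat \<Rightarrow> ('n::finite \<Rightarrow> nat) set" where
  "multi_indices k = {\<alpha>. (\<Sum>i\<in>UNIV. \<alpha> i) = k}"

lemma finite_multi_indices: "finite (multi_indices k :: ('n::finite \<Rightarrow> nat) set)"
proof (rule finite_subset)
  show "multi_indices k \<subseteq> (UNIV :: 'n set) \<rightarrow>\<^sub>E {..k}"
    by (auto simp: multi_indices_def PiE_def intro: member_le_sum)
qed (simp add: finite_PiE)

text \<open>As usual, the zero polynomial counts as homogeneous of every degree.\<close>

definition homogeneous_polynomial :: "nat \<Rightarrow> (complex ^ 'n \<Rightarrow> complex) \<Rightarrow> bool" where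
  "homogeneous_polynomial k p \<longleftrightarrow>
     (\<exists>c. \<forall>z. p z = (\<Sum>\<alpha>\<in>multi_indices k. c \<alpha> * (\<Prod>i\<in>UNIV. (z $ i) ^ \<alpha> i)))"

definition homogeneous_expansion ::
    "(complex ^ 'n \<Rightarrow> complex) \<Rightarrow> (nat \<Rightarrow> complex ^ 'n \<Rightarrow> complex) \<Rightarrow> (complex ^ 'n) set \<Rightarrow> bool" where
  "homogeneous_expansion f P Q \<longleftrightarrow>
     (\<forall>k. homogeneous_polynomial k (P k)) \<and> (\<forall>z\<in>Q. (\<lambda>k. P k z) sums f z)"

definition homothetic :: "real \<Rightarrow> (complex ^ 'n) set \<Rightarrow> (complex ^ 'n) set" where
  "homothetic \<rho> Q = (\<lambda>z. \<rho> *\<^sub>R z) ` Q"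

end

theory Submission
  imports Defs
begin

text \<open>
  Both halves come from one complex variable. For \<open>w \<in> Q\<close> the slice \<open>t \<mapsto> f (t w)\<close> is a power
  series \<open>\<Sum> P\<^sub>k(w) t\<^sup>k\<close>, bounded by \<open>1\<close> on the closed unit disc, so Parseval gives
  \<open>\<Sum> |P\<^sub>k(w)|\<^sup>2 \<le> 1\<close> (\<open>sum_norm_sq_homogeneous_parts_le_1\<close>). At \<open>z = w / sqrt 2\<close> the
  \<open>k\<close>-th part shrinks by the factor \<open>2 powr (-k/2)\<close>, and the squares of these factors sum to exactly
  \<open>1\<close> over \<open>k \<ge> 1\<close>; Cauchy--Schwarz then bounds \<open>\<Sum> |P\<^sub>k(z)|\<close> by \<open>1\<close>.

  Equality in Cauchy--Schwarz asks for coefficients whose moduli are proportional to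
  \<open>2 powr (-k/2)\<close>, and these are the coefficients of \<open>\<phi>(t) = t (t - a) / (1 - a t)\<close> with
  \<open>a = 1 / sqrt 2\<close>. Hence \<open>\<phi>\<close> attains the bound at radius \<open>1 / sqrt 2\<close> and exceeds it at every
  larger radius below \<open>1\<close> (\<open>blaschke_coeff_abs_sum_gt_1\<close>). Convexity transports \<open>\<phi>\<close> to \<open>Q\<close>: a
  hyperplane separating \<open>Q\<close> from an outside point yields a complex linear form \<open>l\<close> with \<open>|l| < 1\<close>
  on \<open>Q\<close> and supremum \<open>1\<close> (\<open>convex_circular_supporting_linear_form\<close>), and \<open>\<phi> \<circ> l\<close> is extremal.
\<close>

section \<open>Power series bounded on the unit circle\<close>

text \<open>
  A discrete Parseval identity: the vectors \<open>(u j ^ k)\<^sub>j\<close> for \<open>k < N\<close> are pairwise orthogonal, because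
  their inner products are geometric sums over a root of unity. Sampling a polynomial of degree
  below \<open>N\<close> at the \<open>N\<close>-th roots of unity replaces integration over the circle.
\<close>

lemma mean_square_over_roots_of_unity:
  fixes a :: "nat \<Rightarrow> complex"
  assumes "N > 0"
  defines "u \<equiv> \<lambda>j::nat. exp (2 * of_real pi * \<i> * of_nat j / of_nat N)"
  shows "(\<Sum>j<N. (cmod (\<Sum>k<N. a k * u j ^ k))\<^sup>2) = N * (\<Sum>k<N. (cmod (a k))\<^sup>2)"
proof -
  have u_pow: "u j ^ k = u k ^ j" for j k
    unfolding u_def by (simp flip: exp_of_nat_mult add: field_simps)
  have u_unity: "u j ^ N = 1" for j
    using complex_root_unity[of N j] assms by (simp add: u_def)
  have cnj_u: "cnj (u k) = inverse (u k)" for k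
    by (simp add: u_def exp_cnj flip: exp_minus)
  have orth: "(\<Sum>j<N. u j ^ k * cnj (u j ^ l)) = (if l = k then of_nat N else 0)"
    if "k < N" "l < N" for k l
  proof -
    define q where "q = u k * inverse (u l)"
    have "u j ^ k * cnj (u j ^ l) = q ^ j" for j
      by (simp add: u_pow[of j] cnj_u q_def power_mult_distrib)
    then have sum_eq: "(\<Sum>j<N. u j ^ k * cnj (u j ^ l)) = (\<Sum>j<N. q ^ j)"
      by simp
    have "q = 1 \<longleftrightarrow> u k = u l"
      by (auto simp: q_def u_def field_simps)
    also have "\<dots> \<longleftrightarrow> l = k"
      using complex_root_unity_eq[of N k l] assms that by (auto simp: u_def cong_def)
    finally have q1: "q = 1 \<longleftrightarrow> l = k" .
    show ?thesis
    proof (cases "l = k")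
      case True
      then show ?thesis using q1 sum_eq by simp
    next
      case False
      have "q ^ N = 1"
        by (simp add: q_def power_mult_distrib power_inverse u_unity)
      then show ?thesis
        using False q1 sum_eq by (simp add: geometric_sum)
    qed
  qed
  have "complex_of_real (\<Sum>j<N. (cmod (\<Sum>k<N. a k * u j ^ k))\<^sup>2)
      = (\<Sum>j<N. \<Sum>k<N. \<Sum>l<N. a k * cnj (a l) * (u j ^ k * cnj (u j ^ l)))"
    unfolding of_real_sum complex_norm_square cnj_sum sum_product by (simp add: mult_ac)
  also have "\<dots> = (\<Sum>k<N. \<Sum>l<N. a k * cnj (a l) * (\<Sum>j<N. u j ^ k * cnj (u j ^ l)))"
    unfolding sum_distrib_left
    by (subst sum.swap, rule sum.cong[OF refl], subst sum.swap, rule refl)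
  also have "\<dots> = (\<Sum>k<N. \<Sum>l<N. if l = k then a k * cnj (a l) * of_nat N else 0)"
    by (intro sum.cong refl, subst orth) auto
  also have "\<dots> = complex_of_real (N * (\<Sum>k<N. (cmod (a k))\<^sup>2))"
    unfolding of_real_mult of_real_sum complex_norm_square sum_distrib_left by (simp add: mult_ac)
  finally show ?thesis
    using of_real_eq_iff by blast
qed

text \<open>
  Absolute summability makes the partial sums converge uniformly on the circle. So the \<open>N\<close>-th partial
  sum is bounded there by \<open>1\<close> plus a tail \<open>T N\<close> tending to \<open>0\<close>, and the discrete Parseval identity
  turns this bound into one for the coefficients.
\<close>

lemma sum_norm_sq_coeffs_le_1:
  fixes a :: "nat \<Rightarrow> complex"
  assumes abs: "summable (\<lambda>k. cmod (a k))"
    and bound: "\<And>t. cmod t = 1 \<Longrightarrow> cmod (\<Sum>k. a k * t ^ k) \<le> 1"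
  shows "(\<Sum>k<n. (cmod (a k))\<^sup>2) \<le> 1"
proof -
  define T where "T N = (\<Sum>k. cmod (a (k + N)))" for N
  have abs_tail: "summable (\<lambda>k. cmod (a (k + N)))" for N
    using abs by (rule summable_ignore_initial_segment)
  have partial: "cmod (\<Sum>k<N. a k * t ^ k) \<le> 1 + T N" if t: "cmod t = 1" for t N
  proof -
    have s: "summable (\<lambda>k. cmod (a k * t ^ k))"
      using abs t by (simp add: norm_mult norm_power)
    have "(\<Sum>k<N. a k * t ^ k) = (\<Sum>k. a k * t ^ k) - (\<Sum>k. a (k + N) * t ^ (k + N))"
      using suminf_split_initial_segment[OF summable_norm_cancel[OF s], of N] by simp
    then have "cmod (\<Sum>k<N. a k * t ^ k)
        \<le> cmod (\<Sum>k. a k * t ^ k) + cmod (\<Sum>k. a (k + N) * t ^ (k + N))"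
      by (simp add: norm_triangle_ineq4)
    also have "cmod (\<Sum>k. a (k + N) * t ^ (k + N)) \<le> (\<Sum>k. cmod (a (k + N) * t ^ (k + N)))"
      using abs_tail[of N] t by (intro summable_norm) (simp add: norm_mult norm_power)
    also have "\<dots> = T N"
      using t by (simp add: T_def norm_mult norm_power)
    finally show ?thesis
      using bound[OF t] by simp
  qed
  have "(\<Sum>k<n. (cmod (a k))\<^sup>2) \<le> (1 + T N)\<^sup>2" if N: "N \<ge> max 1 n" for N
  proof -
    let ?u = "\<lambda>j::nat. exp (2 * of_real pi * \<i> * of_nat j / of_nat N)"
    have u: "cmod (?u j) = 1" for j
      by simp
    have "N * (\<Sum>k<n. (cmod (a k))\<^sup>2) \<le> N * (\<Sum>k<N. (cmod (a k))\<^sup>2)"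
      using N by (intro mult_left_mono sum_mono2) auto
    also have "\<dots> = (\<Sum>j<N. (cmod (\<Sum>k<N. a k * ?u j ^ k))\<^sup>2)"
      using N by (subst mean_square_over_roots_of_unity) auto
    also have "\<dots> \<le> (\<Sum>j<N. (1 + T N)\<^sup>2)"
      by (intro sum_mono power_mono partial u norm_ge_zero)
    finally show ?thesis
      using N by simp
  qed
  moreover have "(\<lambda>N. (1 + T N)\<^sup>2) \<longlonglongrightarrow> (1 + 0)\<^sup>2"
    unfolding T_def by (intro tendsto_intros suminf_exist_split2 abs)
  ultimately show ?thesis
    using LIMSEQ_le_const[of "\<lambda>N. (1 + T N)\<^sup>2" 1] by fastforce
qed

text \<open>
  Cauchy--Schwarz against the weights \<open>(1 / sqrt 2) ^ k\<close>. The radius \<open>1 / sqrt 2\<close> is the one for which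
  the squared weights with \<open>k \<ge> 1\<close> add up to \<open>1\<close>, which is why the constant term has to be left out.
\<close>

lemma sum_norm_coeffs_at_inv_sqrt2_le_1:
  fixes a :: "nat \<Rightarrow> complex"
  assumes bessel: "\<And>n. (\<Sum>k<n. (cmod (a k))\<^sup>2) \<le> 1"
  shows "summable (\<lambda>k. cmod (a (Suc k)) * (1 / sqrt 2) ^ Suc k)"
    and "(\<Sum>k. cmod (a (Suc k)) * (1 / sqrt 2) ^ Suc k) \<le> 1"
proof -
  let ?g = "\<lambda>k. cmod (a (Suc k)) * (1 / sqrt 2) ^ Suc k"
  have partial: "(\<Sum>k<n. ?g k) \<le> 1" for n
  proof -
    have "(\<Sum>k<n. (cmod (a (Suc k)))\<^sup>2) \<le> (\<Sum>k<Suc n. (cmod (a k))\<^sup>2)"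
      by (subst sum.lessThan_Suc_shift) simp
    then have A: "(\<Sum>k<n. (cmod (a (Suc k)))\<^sup>2) \<le> 1"
      using bessel[of "Suc n"] by linarith
    have "(\<Sum>k<n. ((1 / sqrt 2) ^ Suc k)\<^sup>2) = (\<Sum>k<n. (1 / 2 :: real) ^ Suc k)"
      by (intro sum.cong refl) (simp add: power2_eq_square flip: power_mult_distrib)
    also have "\<dots> = 1 - (1 / 2) ^ n"
      by (induction n) (simp_all add: field_simps)
    finally have B: "(\<Sum>k<n. ((1 / sqrt 2) ^ Suc k)\<^sup>2) \<le> 1"
      by simp
    have "(\<Sum>k<n. ?g k)\<^sup>2 \<le> (\<Sum>k<n. (cmod (a (Suc k)))\<^sup>2) * (\<Sum>k<n. ((1 / sqrt 2) ^ Suc k)\<^sup>2)"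
      by (rule Cauchy_Schwarz_ineq_sum)
    also have "\<dots> \<le> 1 * 1"
      using A B by (intro mult_mono sum_nonneg) auto
    finally show ?thesis
      by (simp add: power2_le_imp_le[of _ 1])
  qed
  show "summable ?g"
    by (rule summableI_nonneg_bounded[OF _ partial]) simp
  then show "suminf ?g \<le> 1"
    by (rule suminf_le_const[OF _ partial])
qed

section \<open>Complete circular domains\<close>

lemma homogeneous_polynomial_scale:
  assumes "homogeneous_polynomial k p"
  shows "p (t *s z) = t ^ k * p z"
proof -
  obtain c where c: "\<And>z. p z = (\<Sum>\<alpha>\<in>multi_indices k. c \<alpha> * (\<Prod>i\<in>UNIV. (z $ i) ^ \<alpha> i))"
    using assms unfolding homogeneous_polynomial_def by blast
  have "(\<Prod>i\<in>UNIV. (t * z $ i) ^ \<alpha> i) = t ^ k * (\<Prod>i\<in>UNIV. (z $ i) ^ \<alpha> i)"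
    if "\<alpha> \<in> multi_indices k" for \<alpha>
    using that by (simp add: multi_indices_def power_mult_distrib prod.distrib flip: power_sum)
  then show ?thesis
    by (simp add: c sum_distrib_left mult.left_commute)
qed

lemma scaleR_eq_smult: "r *\<^sub>R (z :: complex ^ 'n) = of_real r *s z"
  unfolding vec_eq_iff vector_scaleR_component vector_smult_component
  by (simp add: scaleR_conv_of_real)

lemma open_contains_larger_multiple:
  fixes w :: "'a :: real_normed_vector"
  assumes "open Q" "w \<in> Q"
  obtains s where "s > 1" "s *\<^sub>R w \<in> Q"
proof -
  have "((\<lambda>s. s *\<^sub>R w) \<longlongrightarrow> 1 *\<^sub>R w) (at_right 1)"
    by (intro tendsto_intros)
  then have "\<forall>\<^sub>F s in at_right (1::real). s *\<^sub>R w \<in> Q"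
    using assms by (auto dest: topological_tendstoD)
  moreover have "\<forall>\<^sub>F s in at_right (1::real). s > 1"
    by (simp add: eventually_at_right_less)
  ultimately have "\<forall>\<^sub>F s in at_right (1::real). s > 1 \<and> s *\<^sub>R w \<in> Q"
    by eventually_elim simp
  then show thesis
    using that eventually_happens trivial_limit_at_right_real by blast
qed

text \<open>
  The coefficient bound for the slice through \<open>w\<close>. Openness of \<open>Q\<close> provides a point \<open>s w \<in> Q\<close> with
  \<open>s > 1\<close>; convergence there makes the slice series absolutely convergent on the closed unit disc.
\<close>

lemma sum_norm_sq_homogeneous_parts_le_1:
  assumes Q: "complete_circular_domain Q"
    and P: "homogeneous_expansion f P Q"
    and f: "\<And>z. z \<in> Q \<Longrightarrow> cmod (f z) < 1"
    and w: "w \<in> Q"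
  shows "(\<Sum>k<n. (cmod (P k w))\<^sup>2) \<le> 1"
proof (rule sum_norm_sq_coeffs_le_1)
  have P_scale: "P k (t *s w) = P k w * t ^ k" for k t
    using P homogeneous_polynomial_scale by (metis homogeneous_expansion_def mult.commute)
  obtain s where s: "s > 1" "s *\<^sub>R w \<in> Q"
    using open_contains_larger_multiple Q w unfolding complete_circular_domain_def by blast
  have "summable (\<lambda>k. P k (of_real s *s w))"
    using P s by (auto simp: homogeneous_expansion_def scaleR_eq_smult sums_iff)
  then have "summable (\<lambda>k. P k w * of_real s ^ k)"
    by (simp add: P_scale)
  from powser_insidea[OF this, of 1] show "summable (\<lambda>k. cmod (P k w))"
    using s by simp
  fix t :: complex
  assume "cmod t = 1"
  then have tw: "t *s w \<in> Q"
    using Q w by (simp add: complete_circular_domain_def)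
  then have "(\<lambda>k. P k w * t ^ k) sums f (t *s w)"
    using P by (auto simp: homogeneous_expansion_def simp flip: P_scale)
  then show "cmod (\<Sum>k. P k w * t ^ k) \<le> 1"
    using f[OF tw] by (simp add: sums_iff)
qed

section \<open>Linear forms\<close>

lemma homogeneous_polynomial_add:
  assumes "homogeneous_polynomial k p" "homogeneous_polynomial k q"
  shows "homogeneous_polynomial k (\<lambda>z. p z + q z)"
proof -
  obtain c where c:
    "\<And>z. p z = (\<Sum>\<alpha>\<in>multi_indices k. c \<alpha> * (\<Prod>i\<in>UNIV. (z $ i) ^ \<alpha> i))"
    using assms(1) unfolding homogeneous_polynomial_def by blast
  obtain d where
    "\<And>z. q z = (\<Sum>\<alpha>\<in>multi_indices k. d \<alpha> * (\<Prod>i\<in>UNIV. (z $ i) ^ \<alpha> i))"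
    using assms(2) unfolding homogeneous_polynomial_def by blast
  with c show ?thesis
    unfolding homogeneous_polynomial_def
    by (intro exI[of _ "\<lambda>\<alpha>. c \<alpha> + d \<alpha>"]) (simp add: sum.distrib algebra_simps)
qed

lemma homogeneous_polynomial_cmult:
  assumes "homogeneous_polynomial k p"
  shows "homogeneous_polynomial k (\<lambda>z. b * p z)"
proof -
  obtain c where "\<And>z. p z = (\<Sum>\<alpha>\<in>multi_indices k. c \<alpha> * (\<Prod>i\<in>UNIV. (z $ i) ^ \<alpha> i))"
    using assms unfolding homogeneous_polynomial_def by blast
  then show ?thesis
    unfolding homogeneous_polynomial_def
    by (intro exI[of _ "\<lambda>\<alpha>. b * c \<alpha>"]) (simp add: sum_distrib_left algebra_simps)
qed

lemma homogeneous_polynomial_sum: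
  assumes "\<And>j. j \<in> J \<Longrightarrow> homogeneous_polynomial k (p j)"
  shows "homogeneous_polynomial k (\<lambda>z. \<Sum>j\<in>J. p j z)"
proof -
  have zero: "homogeneous_polynomial k (\<lambda>z. 0)"
    unfolding homogeneous_polynomial_def by (intro exI[of _ "\<lambda>_. 0"]) simp
  show ?thesis
    using assms
    by (induction J rule: infinite_finite_induct) (simp_all add: zero homogeneous_polynomial_add)
qed

text \<open>
  Multiplying by \<open>z $ j\<close> raises the \<open>j\<close>-th exponent, an injection of the multi-indices of weight \<open>k\<close>
  onto those of weight \<open>Suc k\<close> with positive \<open>j\<close>-th entry; the remaining multi-indices receive the
  coefficient \<open>0\<close>.
\<close>

lemma homogeneous_polynomial_coordinate_mult:
  fixes p :: "complex ^ 'n \<Rightarrow> complex"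
  assumes "homogeneous_polynomial k p"
  shows "homogeneous_polynomial (Suc k) (\<lambda>z. z $ j * p z)"
proof -
  obtain c where c: "\<And>z. p z = (\<Sum>\<alpha>\<in>multi_indices k. c \<alpha> * (\<Prod>i\<in>UNIV. (z $ i) ^ \<alpha> i))"
    using assms unfolding homogeneous_polynomial_def by blast
  define up where "up \<alpha> = \<alpha>(j := Suc (\<alpha> j))" for \<alpha> :: "'n \<Rightarrow> nat"
  define down where "down \<alpha> = \<alpha>(j := \<alpha> j - 1)" for \<alpha> :: "'n \<Rightarrow> nat"
  have down_up: "down (up \<alpha>) = \<alpha>" for \<alpha>
    by (auto simp: down_def up_def)
  have sum_up: "(\<Sum>i\<in>UNIV. up \<alpha> i) = Suc (\<Sum>i\<in>UNIV. \<alpha> i)" for \<alpha>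
  proof -
    have "(\<Sum>i\<in>UNIV - {j}. up \<alpha> i) = (\<Sum>i\<in>UNIV - {j}. \<alpha> i)"
      by (intro sum.cong) (auto simp: up_def)
    then show ?thesis
      using sum.remove[of UNIV j "up \<alpha>"] sum.remove[of UNIV j \<alpha>] by (simp add: up_def)
  qed
  have up_down: "up (down \<alpha>) = \<alpha>" if "\<alpha> j > 0" for \<alpha>
    using that by (auto simp: down_def up_def)
  have mono_up: "(\<Prod>i\<in>UNIV. (z $ i) ^ up \<alpha> i) = z $ j * (\<Prod>i\<in>UNIV. (z $ i) ^ \<alpha> i)"
    for \<alpha> and z :: "complex ^ 'n"
  proof -
    have "(\<Prod>i\<in>UNIV - {j}. (z $ i) ^ up \<alpha> i) = (\<Prod>i\<in>UNIV - {j}. (z $ i) ^ \<alpha> i)"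
      by (intro prod.cong) (auto simp: up_def)
    then show ?thesis
      using prod.remove[of UNIV j "\<lambda>i. (z $ i) ^ up \<alpha> i"]
        prod.remove[of UNIV j "\<lambda>i. (z $ i) ^ \<alpha> i"]
      by (simp add: up_def mult.assoc)
  qed
  have "z $ j * p z = (\<Sum>\<beta>\<in>multi_indices (Suc k).
          (if \<beta> j > 0 then c (down \<beta>) else 0) * (\<Prod>i\<in>UNIV. (z $ i) ^ \<beta> i))" for z
  proof -
    have "z $ j * p z = (\<Sum>\<alpha>\<in>multi_indices k. c \<alpha> * (\<Prod>i\<in>UNIV. (z $ i) ^ up \<alpha> i))"
      by (simp add: c mono_up sum_distrib_left mult.left_commute)
    also have "\<dots> = (\<Sum>\<beta>\<in>{\<beta> \<in> multi_indices (Suc k). \<beta> j > 0}.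
        c (down \<beta>) * (\<Prod>i\<in>UNIV. (z $ i) ^ \<beta> i))"
    proof (rule sum.reindex_bij_witness[of _ down up])
      fix \<alpha> :: "'n \<Rightarrow> nat"
      assume "\<alpha> \<in> multi_indices k"
      then show "up \<alpha> \<in> {\<beta> \<in> multi_indices (Suc k). \<beta> j > 0}"
        using sum_up[of \<alpha>] by (simp add: multi_indices_def up_def)
    next
      fix \<beta> :: "'n \<Rightarrow> nat"
      assume b: "\<beta> \<in> {\<beta> \<in> multi_indices (Suc k). \<beta> j > 0}"
      then show "down \<beta> \<in> multi_indices k"
        using sum_up[of "down \<beta>"] up_down[of \<beta>] by (simp add: multi_indices_def)
    qed (auto simp: down_up up_down)
    also have "\<dots> = (\<Sum>\<beta>\<in>multi_indices (Suc k).
        (if \<beta> j > 0 then c (down \<beta>) else 0) * (\<Prod>i\<in>UNIV. (z $ i) ^ \<beta> i))"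
      by (intro sum.mono_neutral_cong_left finite_multi_indices) auto
    finally show ?thesis .
  qed
  then show ?thesis
    unfolding homogeneous_polynomial_def
    by (intro exI[of _ "\<lambda>\<beta>. if \<beta> j > 0 then c (down \<beta>) else 0"] allI)
qed

text \<open>
  By induction on \<open>k\<close>, multiplying by one linear form at a time; multinomial coefficients never have
  to be written down.
\<close>

lemma homogeneous_polynomial_linear_form_power:
  "homogeneous_polynomial k (\<lambda>z :: complex ^ 'n. (\<Sum>i\<in>UNIV. c i * z $ i) ^ k)"
proof (induction k)
  case 0
  have "multi_indices 0 = {\<lambda>_ :: 'n. 0}"
    by (auto simp: multi_indices_def)
  then show ?case
    unfolding homogeneous_polynomial_def by (intro exI[of _ "\<lambda>_. 1"]) simp
next
  case (Suc k)
  have "homogeneous_polynomial (Suc k)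
          (\<lambda>z. \<Sum>j\<in>UNIV. c j * (z $ j * (\<Sum>i\<in>UNIV. c i * z $ i) ^ k))"
    by (intro homogeneous_polynomial_sum homogeneous_polynomial_cmult
        homogeneous_polynomial_coordinate_mult Suc)
  then show ?case
    by (simp add: sum_distrib_right mult.assoc)
qed

lemma has_derivative_linear_form:
  "((\<lambda>z. \<Sum>i\<in>UNIV. c i * z $ i) has_derivative (\<lambda>v. \<Sum>i\<in>UNIV. c i * v $ i))
    (at (z :: complex ^ 'n) within S)"
  by (intro derivative_intros has_derivative_sum has_derivative_mult_right
      bounded_linear_imp_has_derivative bounded_linear_vec_nth)

lemma mv_holomorphic_on_compose_linear_form:
  fixes Q :: "(complex ^ 'n) set"
  assumes hol: "\<phi> holomorphic_on ball 0 1"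
    and lt: "\<And>z. z \<in> Q \<Longrightarrow> cmod (\<Sum>i\<in>UNIV. c i * z $ i) < 1"
  shows "mv_holomorphic_on (\<lambda>z. \<phi> (\<Sum>i\<in>UNIV. c i * z $ i)) Q"
  unfolding mv_holomorphic_on_def
proof
  fix z assume z: "z \<in> Q"
  let ?l = "\<lambda>z. \<Sum>i\<in>UNIV. c i * z $ i"
  have "(\<phi> has_derivative (*) (deriv \<phi> (?l z))) (at (?l z))"
    using holomorphic_derivI[OF hol open_ball, of "?l z"] lt[OF z]
    by (simp add: has_field_derivative_def)
  from diff_chain_within[OF has_derivative_linear_form has_derivative_at_withinI[OF this]]
  have "((\<lambda>z. \<phi> (?l z)) has_derivative (\<lambda>v. deriv \<phi> (?l z) * ?l v)) (at z within Q)"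
    by (simp add: o_def)
  moreover have "?l (b *s v) = b * ?l v" for b v
    by (simp add: sum_distrib_left mult.left_commute)
  then have "deriv \<phi> (?l z) * ?l (b *s v) = b * (deriv \<phi> (?l z) * ?l v)" for b v
    by (simp only: mult.left_commute)
  ultimately show "\<exists>L. ((\<lambda>z. \<phi> (?l z)) has_derivative L) (at z within Q) \<and>
      (\<forall>b v. L (b *s v) = b * L v)"
    by blast
qed

text \<open>
  The real functional of a separating hyperplane is the real part of a complex linear form \<open>l\<close>.
  Rotating points of the circular set \<open>Q\<close> upgrades the upper bound on \<open>Re l\<close> to one on \<open>|l|\<close>, and
  dividing by the supremum \<open>M\<close> of \<open>|l|\<close> over \<open>Q\<close> normalises the form. The supremum is not attained,
  since \<open>Q\<close> contains a slightly larger multiple of each of its points.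
\<close>

lemma convex_circular_supporting_linear_form:
  fixes Q :: "(complex ^ 'n) set"
  assumes Q: "complete_circular_domain Q" and "convex Q" "Q \<noteq> UNIV"
  obtains c where "\<And>z. z \<in> Q \<Longrightarrow> cmod (\<Sum>i\<in>UNIV. c i * z $ i) < 1"
    and "\<And>s. s < 1 \<Longrightarrow> \<exists>z\<in>Q. s < cmod (\<Sum>i\<in>UNIV. c i * z $ i)"
proof -
  have "open Q" "0 \<in> Q" and circ: "\<And>z \<xi>. z \<in> Q \<Longrightarrow> cmod \<xi> \<le> 1 \<Longrightarrow> \<xi> *s z \<in> Q"
    using Q by (auto simp: complete_circular_domain_def)
  obtain p where "p \<notin> Q"
    using \<open>Q \<noteq> UNIV\<close> by blast
  then obtain a b where ab: "a \<noteq> 0" "\<And>x. x \<in> Q \<Longrightarrow> inner a x \<le> b"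
    using separating_hyperplane_sets[of Q "{p}"] \<open>convex Q\<close> \<open>0 \<in> Q\<close> by auto
  define l where "l z = (\<Sum>i\<in>UNIV. cnj (a $ i) * z $ i)" for z :: "complex ^ 'n"
  have Re_l: "Re (l z) = inner a z" for z
    by (simp add: l_def inner_vec_def inner_complex_def)
  have l_smult: "l (t *s z) = t * l z" for t z
    by (simp add: l_def sum_distrib_left mult.left_commute)
  have l_le: "cmod (l z) \<le> b" if "z \<in> Q" for z
  proof -
    \<comment> \<open>rotate \<open>z\<close> so that \<open>l z\<close> becomes real and nonnegative\<close>
    define \<xi> where "\<xi> = cnj (sgn (l z))"
    have "\<xi> * l z = of_real (cmod (l z))"
      by (cases "l z = 0")
        (simp_all add: \<xi>_def sgn_eq complex_norm_square[symmetric] mult.commute[of "cnj _"] power2_eq_square)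
    then have "inner a (\<xi> *s z) = cmod (l z)"
      by (metis Re_l l_smult Re_complex_of_real)
    moreover have "\<xi> *s z \<in> Q"
      by (rule circ[OF that]) (simp add: \<xi>_def norm_sgn)
    ultimately show ?thesis
      using ab(2) by metis
  qed
  define M where "M = (SUP z\<in>Q. cmod (l z))"
  have bdd: "bdd_above ((\<lambda>z. cmod (l z)) ` Q)"
    using l_le by (rule bdd_aboveI2)
  have le_M: "cmod (l z) \<le> M" if "z \<in> Q" for z
    unfolding M_def by (rule cSUP_upper[OF that bdd])
  have less_M: "cmod (l z) < M" if z: "z \<in> Q" "l z \<noteq> 0" for z
  proof -
    obtain s where s: "s > 1" "s *\<^sub>R z \<in> Q"
      using open_contains_larger_multiple \<open>open Q\<close> z(1) .
    have "cmod (l z) < s * cmod (l z)"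
      using s z by simp
    also have "\<dots> = cmod (l (s *\<^sub>R z))"
      using s by (simp add: scaleR_eq_smult l_smult norm_mult)
    also have "\<dots> \<le> M"
      using s by (intro le_M)
    finally show ?thesis .
  qed
  \<comment> \<open>a small multiple of the normal vector \<open>a\<close> lies in \<open>Q\<close>, so \<open>l\<close> does not vanish identically on \<open>Q\<close>\<close>
  obtain e where e: "e > 0" "ball 0 e \<subseteq> Q"
    using \<open>open Q\<close> \<open>0 \<in> Q\<close> open_contains_ball by blast
  define z0 where "z0 = (e / 2 / norm a) *\<^sub>R a"
  have "z0 \<in> Q"
    using e ab(1) by (intro subsetD[OF e(2)]) (simp add: z0_def)
  moreover have "Re (l z0) > 0"
    using e ab(1) by (simp add: Re_l z0_def)
  ultimately have M_pos: "M > 0"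
    using less_M[of z0] by (smt (verit) norm_ge_zero zero_complex.sel(1))
  have l_div: "(\<Sum>i\<in>UNIV. cnj (a $ i) / of_real M * z $ i) = l z / of_real M" for z
    by (simp add: l_def sum_divide_distrib)
  show thesis
  proof
    fix z assume z: "z \<in> Q"
    have "cmod (l z) < M"
      using less_M[OF z] M_pos by (cases "l z = 0") auto
    then show "cmod (\<Sum>i\<in>UNIV. cnj (a $ i) / of_real M * z $ i) < 1"
      unfolding l_div using M_pos by (simp add: norm_divide)
  next
    fix s :: real assume "s < 1"
    then have "s * M < M"
      using M_pos by simp
    then obtain z where "z \<in> Q" "s * M < cmod (l z)"
      using less_cSUP_iff[OF _ bdd] \<open>0 \<in> Q\<close> unfolding M_def by blast
    then show "\<exists>z\<in>Q. s < cmod (\<Sum>i\<in>UNIV. cnj (a $ i) / of_real M * z $ i)"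
      unfolding l_div using M_pos
      by (intro bexI[of _ z]) (simp_all add: norm_divide field_simps)
  qed
qed

section \<open>The extremal function\<close>

text \<open>
  The Taylor coefficients of \<open>t (t - a) / (1 - a t)\<close>. The quotient \<open>(t - a) / (1 - a t)\<close> equals
  \<open>- a + (1 - a\<^sup>2) t / (1 - a t)\<close>, hence the geometric progression from degree \<open>2\<close> on.
\<close>

fun blaschke_coeff :: "real \<Rightarrow> nat \<Rightarrow> real" where
  "blaschke_coeff a 0 = 0"
| "blaschke_coeff a (Suc 0) = - a"
| "blaschke_coeff a (Suc (Suc j)) = (1 - a\<^sup>2) * a ^ j"

lemma blaschke_coeff_sums:
  fixes t :: complex
  assumes a: "0 \<le> a" "a < 1" and t: "cmod t < 1"
  shows "(\<lambda>k. of_real (blaschke_coeff a k) * t ^ k) sums (t * Moebius_function 0 (of_real a) t)"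
proof -
  let ?q = "of_real a * t"
  have q: "cmod ?q < 1"
    using a t mult_strict_mono[of a 1 "cmod t" 1] by (simp add: norm_mult)
  then have ne: "1 - ?q \<noteq> 0"
    by auto
  have "(\<lambda>j. (1 - (of_real a)\<^sup>2) * t ^ 2 * ?q ^ j)
      sums ((1 - (of_real a)\<^sup>2) * t ^ 2 * (1 / (1 - ?q)))"
    by (intro sums_mult geometric_sums q)
  then have "(\<lambda>j. of_real (blaschke_coeff a (Suc (Suc j))) * t ^ Suc (Suc j))
      sums ((1 - (of_real a)\<^sup>2) * t ^ 2 * (1 / (1 - ?q)))"
    by (simp add: power2_eq_square power_mult_distrib mult_ac)
  then have "(\<lambda>k. of_real (blaschke_coeff a k) * t ^ k)
      sums ((1 - (of_real a)\<^sup>2) * t ^ 2 * (1 / (1 - ?q)) - of_real a * t)"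
    using sums_Suc[of "\<lambda>k. of_real (blaschke_coeff a k) * t ^ k",
        OF sums_Suc[of "\<lambda>k. of_real (blaschke_coeff a (Suc k)) * t ^ Suc k"]]
    by simp
  also have "(1 - (of_real a)\<^sup>2) * t ^ 2 * (1 / (1 - ?q)) - of_real a * t
      = t * Moebius_function 0 (of_real a) t"
    using ne by (simp add: Moebius_function_simple field_simps power2_eq_square)
  finally show ?thesis .
qed

lemma blaschke_coeff_abs_sums:
  assumes a: "0 \<le> a" "a < 1" and r: "0 \<le> r" "r < 1"
  shows "(\<lambda>k. \<bar>blaschke_coeff a (Suc k)\<bar> * r ^ Suc k) sums (r * (a + (1 - a\<^sup>2) * r / (1 - a * r)))"
proof -
  have q: "norm (a * r) < 1"
    using a r mult_strict_mono[of a 1 r 1] by simp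
  have a2: "a\<^sup>2 \<le> 1"
    using a by (simp add: power_le_one)
  have "(\<lambda>j. (1 - a\<^sup>2) * r ^ 2 * (a * r) ^ j) sums ((1 - a\<^sup>2) * r ^ 2 * (1 / (1 - a * r)))"
    by (intro sums_mult geometric_sums q)
  then have "(\<lambda>j. \<bar>blaschke_coeff a (Suc (Suc j))\<bar> * r ^ Suc (Suc j))
      sums ((1 - a\<^sup>2) * r ^ 2 * (1 / (1 - a * r)))"
    using a a2 by (simp add: power2_eq_square power_mult_distrib abs_mult mult_ac)
  then have "(\<lambda>k. \<bar>blaschke_coeff a (Suc k)\<bar> * r ^ Suc k)
      sums ((1 - a\<^sup>2) * r ^ 2 * (1 / (1 - a * r)) + a * r)"
    using a sums_Suc[of "\<lambda>k. \<bar>blaschke_coeff a (Suc k)\<bar> * r ^ Suc k"] by simp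
  then show ?thesis
    by (simp add: distrib_left power2_eq_square mult_ac add.commute)
qed

text \<open>
  At \<open>a = r = 1 / sqrt 2\<close> the two summands \<open>a r\<close> and \<open>(1 - a\<^sup>2) r\<^sup>2 / (1 - a r)\<close> are both \<open>1 / 2\<close>, and
  each increases strictly with \<open>r\<close> while \<open>a\<close> stays fixed.
\<close>

lemma blaschke_coeff_abs_sum_gt_1:
  assumes r: "1 / sqrt 2 < r" "r < 1"
  defines "a \<equiv> 1 / sqrt 2"
  shows "r * (a + (1 - a\<^sup>2) * r / (1 - a * r)) > 1"
proof -
  have a: "0 < a" "a < 1" "a\<^sup>2 = 1 / 2" "a < r"
    using r by (simp_all add: a_def power2_eq_square)
  have ra: "1 / 2 < a * r" "1 / 2 < r * r"
    using mult_strict_left_mono[of a r a] mult_strict_mono[of a r a r] a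
    unfolding power2_eq_square by linarith+
  have "a * r < 1"
    using a r mult_strict_mono[of a 1 r 1] by simp
  then have "(1 - a\<^sup>2) * (r * r) / (1 - a * r) > 1 / 2"
    using ra a(3) by (simp add: field_simps)
  then have "a * r + (1 - a\<^sup>2) * (r * r) / (1 - a * r) > 1"
    using ra by linarith
  then show ?thesis
    by (simp add: distrib_left mult_ac)
qed

theorem theorem2:
  fixes Q :: "(complex ^ 'n) set"
  assumes "complete_circular_domain Q"
  shows "(\<forall>f P. mv_holomorphic_on f Q \<and> homogeneous_expansion f P Q \<and>
              f 0 = 0 \<and> (\<forall>z\<in>Q. cmod (f z) < 1) \<longrightarrow>
            (\<forall>z\<in>homothetic (1 / sqrt 2) Q.
               summable (\<lambda>k. cmod (P (Suc k) z)) \<and> (\<Sum>k. cmod (P (Suc k) z)) \<le> 1)) \<and>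
         (convex Q \<and> Q \<noteq> UNIV \<longrightarrow>
            (\<forall>\<rho>. 1 / sqrt 2 < \<rho> \<and> \<rho> \<le> 1 \<longrightarrow>
               (\<exists>f P. mv_holomorphic_on f Q \<and> homogeneous_expansion f P Q \<and>
                  f 0 = 0 \<and> (\<forall>z\<in>Q. cmod (f z) < 1) \<and>
                  (\<exists>z\<in>homothetic \<rho> Q.
                     summable (\<lambda>k. cmod (P (Suc k) z)) \<and> (\<Sum>k. cmod (P (Suc k) z)) > 1))))"
proof (intro conjI allI impI ballI; (elim conjE)?)
  fix f P z
  assume P: "homogeneous_expansion f P Q" and f: "\<forall>z\<in>Q. cmod (f z) < 1"
    and "z \<in> homothetic (1 / sqrt 2) Q"
  then obtain w where w: "w \<in> Q" and z: "z = (1 / sqrt 2) *\<^sub>R w"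
    by (auto simp: homothetic_def)
  have "P k z = of_real (1 / sqrt 2) ^ k * P k w" for k
    unfolding z scaleR_eq_smult
    using P homogeneous_polynomial_scale by (metis homogeneous_expansion_def)
  then have "cmod (P k z) = cmod (P k w) * (1 / sqrt 2) ^ k" for k
    by (simp add: norm_mult norm_power norm_divide)
  moreover have "\<And>n. (\<Sum>k<n. (cmod (P k w))\<^sup>2) \<le> 1"
    using sum_norm_sq_homogeneous_parts_le_1[OF assms P _ w] f by blast
  ultimately show "summable (\<lambda>k. cmod (P (Suc k) z))" "(\<Sum>k. cmod (P (Suc k) z)) \<le> 1"
    using sum_norm_coeffs_at_inv_sqrt2_le_1[of "\<lambda>k. P k w"] by simp_all
next
  fix \<rho> :: real
  assume "convex Q" "Q \<noteq> UNIV" and \<rho>: "1 / sqrt 2 < \<rho>" "\<rho> \<le> 1"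
  obtain c where lt: "\<And>z. z \<in> Q \<Longrightarrow> cmod (\<Sum>i\<in>UNIV. c i * z $ i) < 1"
    and sup: "\<And>s. s < 1 \<Longrightarrow> \<exists>z\<in>Q. s < cmod (\<Sum>i\<in>UNIV. c i * z $ i)"
    using convex_circular_supporting_linear_form[OF assms \<open>convex Q\<close> \<open>Q \<noteq> UNIV\<close>] by blast
  define l where "l z = (\<Sum>i\<in>UNIV. c i * z $ i)" for z :: "complex ^ 'n"
  define a :: real where "a = 1 / sqrt 2"
  have a: "0 < a" "a < 1"
    by (simp_all add: a_def)
  define \<phi> where "\<phi> t = t * Moebius_function 0 (of_real a) t" for t
  define f where "f z = \<phi> (l z)" for z
  define P where "P k z = of_real (blaschke_coeff a k) * l z ^ k" for k z
  have "\<phi> holomorphic_on ball 0 1"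
    unfolding \<phi>_def using a by (intro holomorphic_intros Moebius_function_holomorphic) simp
  then have hol: "mv_holomorphic_on f Q"
    unfolding f_def l_def using lt by (rule mv_holomorphic_on_compose_linear_form)
  have expansion: "homogeneous_expansion f P Q"
    unfolding homogeneous_expansion_def
  proof (intro conjI allI ballI)
    show "homogeneous_polynomial k (P k)" for k
      unfolding P_def l_def
      by (intro homogeneous_polynomial_cmult homogeneous_polynomial_linear_form_power)
    show "(\<lambda>k. P k z) sums f z" if "z \<in> Q" for z
      unfolding P_def f_def \<phi>_def
      using a lt[OF that] by (intro blaschke_coeff_sums) (simp_all add: l_def)
  qed
  have f0: "f 0 = 0"
    by (simp add: f_def \<phi>_def l_def)
  have f_lt: "\<forall>z\<in>Q. cmod (f z) < 1"
  proof
    fix z assume "z \<in> Q"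
    then have "cmod (l z) < 1"
      using lt by (simp add: l_def)
    moreover from this have "cmod (Moebius_function 0 (of_real a) (l z)) < 1"
      using a by (intro Moebius_function_norm_lt_1) simp_all
    ultimately show "cmod (f z) < 1"
      using mult_strict_mono[of "cmod (l z)" 1 "cmod (Moebius_function 0 (of_real a) (l z))" 1]
      by (simp add: f_def \<phi>_def norm_mult)
  qed
  have "\<rho> > 0"
    using \<rho>(1) a(1) unfolding a_def by linarith
  then have "a / \<rho> < 1"
    using \<rho>(1) by (simp only: a_def divide_less_eq_1_pos)
  \<comment> \<open>after shrinking by \<open>\<rho>\<close>, the point \<open>w\<close> must still have \<open>|l| > a\<close>\<close>
  then obtain w where w: "w \<in> Q" "a / \<rho> < cmod (l w)"
    using sup unfolding l_def by blast
  define z where "z = \<rho> *\<^sub>R w"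
  define r where "r = cmod (l z)"
  have "l z = of_real \<rho> * l w"
    by (simp add: z_def l_def scaleR_eq_smult sum_distrib_left mult.left_commute)
  then have r_eq: "r = \<rho> * cmod (l w)"
    using \<open>\<rho> > 0\<close> by (simp add: r_def norm_mult)
  have r: "a < r" "r < 1"
  proof -
    show "a < r"
      using w \<open>\<rho> > 0\<close> by (simp add: r_eq field_simps)
    have "r \<le> 1 * cmod (l w)"
      unfolding r_eq using \<rho> by (intro mult_right_mono) auto
    then show "r < 1"
      using lt[OF w(1)] by (simp add: l_def)
  qed
  have "(\<lambda>k. cmod (P (Suc k) z)) sums (r * (a + (1 - a\<^sup>2) * r / (1 - a * r)))"
    using blaschke_coeff_abs_sums[of a r] a r by (simp add: P_def norm_mult norm_power r_def)
  moreover have "r * (a + (1 - a\<^sup>2) * r / (1 - a * r)) > 1"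
    using blaschke_coeff_abs_sum_gt_1[of r] r by (simp add: a_def)
  moreover have "z \<in> homothetic \<rho> Q"
    using w(1) unfolding homothetic_def z_def by (rule imageI)
  ultimately have "\<exists>z\<in>homothetic \<rho> Q.
      summable (\<lambda>k. cmod (P (Suc k) z)) \<and> (\<Sum>k. cmod (P (Suc k) z)) > 1"
    by (auto simp: sums_iff)
  then show "\<exists>f P. mv_holomorphic_on f Q \<and> homogeneous_expansion f P Q \<and>
      f 0 = 0 \<and> (\<forall>z\<in>Q. cmod (f z) < 1) \<and>
      (\<exists>z\<in>homothetic \<rho> Q.
         summable (\<lambda>k. cmod (P (Suc k) z)) \<and> (\<Sum>k. cmod (P (Suc k) z)) > 1)"
    using hol expansion f0 f_lt by blast
qed

end
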